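(* Let $d\geq 3$, let $x_1,\ldots,x_8\in\mathbb{R}^d$ be the eight points listed in the context, and let $m\geq 1$ be an integer. For any $w_1,\ldots,w_m\in\mathbb{R}^d$, the matrix $E\in\mathbb{R}^{8\times m}$ with entries $E_{ij}=(x_i^Tw_j)_+$ has rank at most $7$.
   Context: For $z\in\mathbb{R}$, $(z)_+=z$ if $z>0$ and $(z)_+=0$ if $z\le 0$ (the ReLU function). With $s=1/\sqrt{3}$ and $\mathbf{0}\in\mathbb{R}^{d-3}$ the zero vector, the eight points are $x_1=(s,s,s,\mathbf{0})$, $x_2=(-s,s,s,\mathbf{0})$, $x_3=(s,-s,s,\mathbf{0})$, $x_4=(s,s,-s,\mathbf{0})$, $x_5=(-s,-s,s,\mathbf{0})$, $x_6=(-s,s,-s,\mathbf{0})$, $x_7=(s,-s,-s,\mathbf{0})$, $x_8=(-s,-s,-s,\mathbf{0})$. *)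

theory Defs
  imports Complex_Main "Jordan_Normal_Form.DL_Rank"
begin

definition relu :: "real \<Rightarrow> real" where
  "relu z = (if z > 0 then z else 0)"

(* (a s, b s, c s, 0, ..., 0) with s = 1 / sqrt 3; it has d entries when d >= 3. *)
definition cube_point :: "nat \<Rightarrow> real \<Rightarrow> real \<Rightarrow> real \<Rightarrow> real vec" where
  "cube_point d a b c =
     (let s = 1 / sqrt 3 in vec_of_list [a * s, b * s, c * s] @\<^sub>v 0\<^sub>v (d - 3))"

(* The points x_1, ..., x_8, in this order; x_i is the list entry with index i - 1. *)
definition points :: "nat \<Rightarrow> real vec list" where
  "points d =
     [cube_point d 1 1 1,
      cube_point d (-1) 1 1,
      cube_point d 1 (-1) 1,
      cube_point d 1 1 (-1),
      cube_point d (-1) (-1) 1,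
      cube_point d (-1) 1 (-1),
      cube_point d 1 (-1) (-1),
      cube_point d (-1) (-1) (-1)]"

(* Rows and columns are numbered from 0, so w_1, ..., w_m are w 0, ..., w (m - 1). *)
definition relu_matrix :: "nat \<Rightarrow> nat \<Rightarrow> (nat \<Rightarrow> real vec) \<Rightarrow> real mat" where
  "relu_matrix d m w = mat 8 m (\<lambda>(i, j). relu ((points d ! i) \<bullet> w j))"

end

theory Submission
  imports Defs
begin

text \<open>
  The rows of the matrix satisfy one linear relation that does not depend on the vectors
  \<open>w j\<close>. Since \<open>relu z - relu (- z) = z\<close>, a combination of the rows whose
  coefficients take opposite values at antipodal points loses the nonlinearity: on each of the
  four antipodal pairs it leaves a multiple of the linear functional \<open>\<lambda>u. x \<bullet> u\<close>. The four
  representatives span only a three-dimensional space, so these functionals are dependent. By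
  symmetry, the coefficients can be given by the parity \<open>a * b * c\<close> of the sign pattern
  \<open>(a, b, c)\<close>, which is odd under negation; the dependency is
  \<open>(1, 1, 1) - (-1, 1, 1) - (1, -1, 1) - (1, 1, -1) = 0\<close>.

  Thus the parity vector is orthogonal to every column. It is not orthogonal to itself, so it lies
  outside the column span, which is therefore a proper subspace of the eight-dimensional space.
\<close>

text \<open>
  Adjoining \<open>v\<close> to a maximal independent set of columns keeps it independent, because
  everything in the column span is orthogonal to \<open>v\<close> whereas \<open>v\<close> itself is not.
  The enlarged set has at most \<open>n\<close> elements. The condition \<open>v \<bullet> v \<noteq> 0\<close>,
  rather than \<open>v \<noteq> 0\<close>, lets the argument work over fields with isotropic vectors.
\<close>
lemma (in vec_space) rank_less_if_cols_orthogonal: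
  assumes A: "A \<in> carrier_mat n nc"
    and v: "v \<in> carrier_vec n" "v \<bullet> v \<noteq> 0"
    and orth: "\<And>x. x \<in> set (cols A) \<Longrightarrow> v \<bullet> x = 0"
  shows "rank A < n"
proof -
  have cols: "set (cols A) \<subseteq> carrier_vec n"
    using cols_dim A by blast
  have "lin_indpt {}"
    unfolding lin_dep_def by blast
  then obtain U where U: "finite U" "maximal U (\<lambda>T. T \<subseteq> set (cols A) \<and> lin_indpt T)"
    using maximal_exists_superset[of "set (cols A)" "\<lambda>T. T \<subseteq> set (cols A) \<and> lin_indpt T" "{}"]
    by blast
  then have UA: "U \<subseteq> set (cols A)" and indpt: "lin_indpt U"
    by (auto simp: maximal_def)
  have Uc: "U \<subseteq> carrier_vec n"
    using UA cols by blast
  have "v \<in> orthogonal_complement U"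
    using v(1) orth UA by (auto simp: orthogonal_complement_def)
  then have "v \<in> orthogonal_complement (span U)"
    by (simp add: in_orthogonal_complement_span[OF Uc])
  then have notin_span: "v \<notin> span U"
    using v(2) by (auto simp: orthogonal_complement_def)
  then have notin: "v \<notin> U"
    using span_mem Uc by auto
  have "lin_indpt (U \<union> {v})"
    using lin_dep_iff_in_span[of U v] indpt Uc v(1) notin notin_span by auto
  then have "card (U \<union> {v}) \<le> n"
    using li_le_dim(2)[of "U \<union> {v}"] Uc v(1) by (simp add: dim_is_n)
  then show ?thesis
    using rank_card_indpt[OF A U(2)] U(1) notin by simp
qed

lemma scalar_prod_cube_point:
  assumes "d \<ge> 3" "u \<in> carrier_vec d"
  shows "cube_point d a b c \<bullet> u = (a * u $ 0 + b * u $ 1 + c * u $ 2) / sqrt 3"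
proof -
  define s where "s = 1 / sqrt 3"
  obtain k where d: "d = 3 + k"
    using assms(1) le_Suc_ex by blast
  have "cube_point d a b c \<bullet> u = (\<Sum>i = 0..<3 + k. cube_point d a b c $ i * u $ i)"
    using assms(2) by (simp add: scalar_prod_def d)
  also have "\<dots> = (\<Sum>i = 0..<3. cube_point d a b c $ i * u $ i)"
  proof (rule sum.mono_neutral_right)
    show "\<forall>i \<in> {0..<3 + k} - {0..<3}. cube_point d a b c $ i * u $ i = 0"
      by (auto simp: cube_point_def d append_vec_def Let_def)
  qed auto
  also have "\<dots> = a * s * u $ 0 + b * s * u $ 1 + c * s * u $ 2"
    by (simp add: cube_point_def d append_vec_def Let_def s_def numeral_3_eq_3 numeral_2_eq_2)
  finally show ?thesis
    by (simp add: s_def add_divide_distrib)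
qed

lemma relu_minus: "relu (- z) = relu z - z"
  by (simp add: relu_def)

text \<open>
  The values of \<open>a * b * c\<close> at the sign patterns of the eight points, in their order.
\<close>
definition parity_vec :: "real vec" where
  "parity_vec = vec 8 (\<lambda>i. [1, -1, -1, -1, 1, 1, 1, -1] ! i)"

lemma parity_vec_scalar_prod:
  assumes "u \<in> carrier_vec 8"
  shows "parity_vec \<bullet> u =
    u $ 0 - u $ 1 - u $ 2 - u $ 3 + u $ 4 + u $ 5 + u $ 6 - u $ 7"
  using assms
  by (simp add: parity_vec_def scalar_prod_def eval_nat_numeral)

text \<open>
  The antipodal pairs are the positions \<open>(0, 7)\<close>, \<open>(1, 6)\<close>, \<open>(2, 5)\<close>
  and \<open>(3, 4)\<close>. Rewriting the second member of each pair with
  \<open>relu_minus\<close> cancels all values of \<open>relu\<close>, and what remains is the linear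
  dependency between the four representatives.
\<close>
lemma parity_vec_orthogonal_relu:
  assumes "d \<ge> 3" "u \<in> carrier_vec d"
  shows "parity_vec \<bullet> vec 8 (\<lambda>i. relu (points d ! i \<bullet> u)) = 0"
proof -
  define s where "s = 1 / sqrt 3"
  define t where "t a b c = s * (a * u $ 0 + b * u $ 1 + c * u $ 2)" for a b c
  have prod: "cube_point d a b c \<bullet> u = t a b c" for a b c
    using scalar_prod_cube_point[OF assms] by (simp add: t_def s_def)
  have neg: "relu (t (- a) (- b) (- c)) = relu (t a b c) - t a b c" for a b c
  proof -
    have "t (- a) (- b) (- c) = - t a b c"
      by (simp add: t_def algebra_simps)
    then show ?thesis
      by (simp add: relu_minus)
  qed
  have "parity_vec \<bullet> vec 8 (\<lambda>i. relu (points d ! i \<bullet> u)) =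
      relu (t 1 1 1) - relu (t (- 1) 1 1) - relu (t 1 (- 1) 1) - relu (t 1 1 (- 1))
      + relu (t (- 1) (- 1) 1) + relu (t (- 1) 1 (- 1)) + relu (t 1 (- 1) (- 1))
      - relu (t (- 1) (- 1) (- 1))"
    by (simp add: parity_vec_scalar_prod points_def prod)
  also have "\<dots> = t 1 1 1 - t (- 1) 1 1 - t 1 (- 1) 1 - t 1 1 (- 1)"
    using neg[of 1 1 1] neg[of "- 1" 1 1] neg[of 1 "- 1" 1] neg[of 1 1 "- 1"] by simp
  also have "\<dots> = 0"
    by (simp add: t_def algebra_simps)
  finally show ?thesis .
qed

theorem theorem2p2:
  fixes d m :: nat and w :: "nat \<Rightarrow> real vec"
  assumes "d \<ge> 3" and "m \<ge> 1"
    and "\<And>j. j < m \<Longrightarrow> w j \<in> carrier_vec d"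
  shows "vec_space.rank 8 (relu_matrix d m w) \<le> 7"
proof -
  have A: "relu_matrix d m w \<in> carrier_mat 8 m"
    by (simp add: relu_matrix_def)
  have v: "parity_vec \<in> carrier_vec 8"
    by (simp add: parity_vec_def)
  have "parity_vec \<bullet> parity_vec = 8"
    unfolding parity_vec_scalar_prod[OF v]
    by (simp add: parity_vec_def)
  then have vv: "parity_vec \<bullet> parity_vec \<noteq> 0"
    by simp
  have "parity_vec \<bullet> x = 0" if "x \<in> set (cols (relu_matrix d m w))" for x
  proof -
    from that obtain j where "j < m" and x: "x = col (relu_matrix d m w) j"
      by (auto simp: cols_def relu_matrix_def)
    then have "x = vec 8 (\<lambda>i. relu (points d ! i \<bullet> w j))"
      by (intro eq_vecI) (simp_all add: relu_matrix_def)
    then show ?thesis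
      using parity_vec_orthogonal_relu[OF assms(1) assms(3)[OF \<open>j < m\<close>]] by simp
  qed
  then have "vec_space.rank 8 (relu_matrix d m w) < 8"
    by (rule vec_space.rank_less_if_cols_orthogonal[OF A v vv])
  then show ?thesis
    by simp
qed

end
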